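(* Let $d\ge 1$ be an integer and let $\mathbf{x}^{(1)},\mathbf{x}^{(2)},\dots$ be the probability vectors (in $\mathbb{R}^d$, written as rows) of a time-dependent Markov chain with $d\times d$ doubly stochastic transition matrices $\mathfrak{D}_{12},\mathfrak{D}_{23},\dots$, i.e. $\mathbf{x}^{(1)}$ is a probability vector and $\mathbf{x}^{(s+1)}=\mathbf{x}^{(s)}\mathfrak{D}_{s,s+1}$ for all $s\ge 1$. Let $\mathcal{A}[\mathbf{x}^{(1)}]$ be the convex polytope associated with $\mathbf{x}^{(1)}$ (defined in the context). Then: (1) Every future probability vector $\mathbf{x}^{(s+1)}$ with $s>0$ belongs to $\mathcal{A}[\mathbf{x}^{(1)}]$. (2) Every probability vector $\mathbf{y}\in\mathcal{A}[\mathbf{x}^{(1)}]$ is a potential future probability vector, in the sense that there exists a doubly stochastic matrix $\mathfrak{D}$ such that $\mathbf{y}=\mathbf{x}^{(1)}\mathfrak{D}$.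
   Context: A probability vector is a row vector $\mathbf{x}=(x_0,\dots,x_{d-1})$ with $x_i\ge 0$ and $\sum_i x_i=1$. A $d\times d$ real matrix is doubly stochastic if its entries are non-negative and all its row sums and column sums equal $1$. Vectors are rows and are multiplied by matrices on the right. For a permutation $\pi$ of $\{0,\dots,d-1\}$, the permutation matrix $M_\pi$ has entries $M_\pi(a,b)=\delta(\pi(a),b)$ (Kronecker delta), and for a probability vector $\mathbf{x}$ one sets $\mathbf{x}_\pi=\mathbf{x}M_\pi=(x_{\pi^{-1}(0)},\dots,x_{\pi^{-1}(d-1)})$. A probability vector $\mathbf{x}$ is represented by its first $d-1$ components, $\widehat{\mathbf{x}}=(x_0,\dots,x_{d-2})$ (the last component is determined by the others). The convex polytope associated with $\mathbf{x}$ is $$\mathcal{A}[\mathbf{x}]=\Big\{\sum_{\pi}\lambda(\pi)\,\widehat{\mathbf{x}}_\pi \;:\; \lambda(\pi)\ge 0,\ \sum_\pi\lambda(\pi)=1\Big\},$$ the sums running over all $d!$ permutations $\pi$. A probability vector $\mathbf{y}$ is said to belong to $\mathcal{A}[\mathbf{x}]$ if $\widehat{\mathbf{y}}\in\mathcal{A}[\mathbf{x}]$. *)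

theory Defs
  imports Complex_Main "HOL-Combinatorics.Permutations" "Jordan_Normal_Form.Matrix"
begin

definition prob_vec :: "nat \<Rightarrow> real vec \<Rightarrow> bool" where
  "prob_vec d x \<longleftrightarrow> x \<in> carrier_vec d \<and> (\<forall>i<d. x $ i \<ge> 0) \<and> (\<Sum>i<d. x $ i) = 1"

definition doubly_stochastic :: "nat \<Rightarrow> real mat \<Rightarrow> bool" where
  "doubly_stochastic d A \<longleftrightarrow> A \<in> carrier_mat d d \<and>
     (\<forall>i<d. \<forall>j<d. A $$ (i, j) \<ge> 0) \<and>
     (\<forall>i<d. (\<Sum>j<d. A $$ (i, j)) = 1) \<and>
     (\<forall>j<d. (\<Sum>i<d. A $$ (i, j)) = 1)"

text \<open>Vectors are rows here and are multiplied by matrices on the right, whereas the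
  library product \<^const>\<open>mult_mat_vec\<close> treats them as columns.\<close>

definition mult_vec_mat :: "real vec \<Rightarrow> real mat \<Rightarrow> real vec" (infixl \<open>\<^sub>v*\<close> 70) where
  "x \<^sub>v* A = vec (dim_col A) (\<lambda>j. x \<bullet> col A j)"

definition perm_mat :: "nat \<Rightarrow> (nat \<Rightarrow> nat) \<Rightarrow> real mat" where
  "perm_mat d \<pi> = mat d d (\<lambda>(a, b). if \<pi> a = b then 1 else 0)"

definition perm_vec :: "(nat \<Rightarrow> nat) \<Rightarrow> real vec \<Rightarrow> real vec" where
  "perm_vec \<pi> x = x \<^sub>v* perm_mat (dim_vec x) \<pi>"

lemma perm_vec_eq:
  assumes "\<pi> permutes {..<dim_vec x}"
  shows "perm_vec \<pi> x = vec (dim_vec x) (\<lambda>i. x $ inv_into UNIV \<pi> i)"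
proof (rule eq_vecI)
  fix i assume "i < dim_vec (vec (dim_vec x) (\<lambda>i. x $ inv_into UNIV \<pi> i))"
  then have i: "i < dim_vec x" by simp
  have inv: "inv_into UNIV \<pi> i < dim_vec x"
    using permutes_in_image[OF permutes_inv[OF assms], of i] i by simp
  have "perm_vec \<pi> x $ i = (\<Sum>a = 0..<dim_vec x. x $ a * (if \<pi> a = i then 1 else 0))"
    using i by (simp add: perm_vec_def mult_vec_mat_def perm_mat_def scalar_prod_def)
  also have "\<dots> = (\<Sum>a = 0..<dim_vec x. if a = inv_into UNIV \<pi> i then x $ a else 0)"
    using permutes_inv_eq[OF assms, of i] by (intro sum.cong refl) (simp, metis)
  also have "\<dots> = x $ inv_into UNIV \<pi> i" using inv by simp
  finally show "perm_vec \<pi> x $ i = vec (dim_vec x) (\<lambda>i. x $ inv_into UNIV \<pi> i) $ i" using i by simp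
qed (simp add: perm_vec_def mult_vec_mat_def perm_mat_def)

definition trunc_vec :: "real vec \<Rightarrow> real vec" where
  "trunc_vec x = vec (dim_vec x - 1) (\<lambda>i. x $ i)"

text \<open>A subset of $d - 1$ dimensional space, where $d$ is the dimension of \<open>x\<close>; for $d = 1$
  the ambient space is the single vector of dimension 0.\<close>

definition polytope_of :: "real vec \<Rightarrow> real vec set" where
  "polytope_of x =
     {finsum_vec TYPE(real) (dim_vec x - 1) (\<lambda>\<pi>. l \<pi> \<cdot>\<^sub>v trunc_vec (perm_vec \<pi> x))
        {\<pi>. \<pi> permutes {..<dim_vec x}} | l.
      (\<forall>\<pi>. \<pi> permutes {..<dim_vec x} \<longrightarrow> l \<pi> \<ge> 0) \<and>
      (\<Sum>\<pi> | \<pi> permutes {..<dim_vec x}. l \<pi>) = (1::real)}"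

definition belongs_to_polytope :: "real vec \<Rightarrow> real vec \<Rightarrow> bool" where
  "belongs_to_polytope y x \<longleftrightarrow> prob_vec (dim_vec x) y \<and> trunc_vec y \<in> polytope_of x"

end

theory Submission
  imports Defs
begin

text \<open>Part (1) is Rado's theorem: a vector \<open>x A\<close> with \<open>A\<close> doubly stochastic is a convex combination
  of the permutations of \<open>x\<close>. After sorting both vectors decreasingly, every prefix sum of \<open>x A\<close> is
  at most that of \<open>x\<close>. A finite sequence of T-transforms, each replacing \<open>x\<close> by a mixture
  of \<open>x\<close> and a transposition of \<open>x\<close>, then turns \<open>x\<close> into \<open>x A\<close> by making at least one
  more coordinate agree at every step. Birkhoff's theorem is thereby avoided. For part (2), the same
  weights mix the permutation matrices; the truncated last coordinate is recovered from
  the total mass 1.\<close>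

section \<open>Convex hull of the permutations of a vector\<close>

text \<open>Vectors are functions of which only the values below \<open>d\<close> count, and the
  last coordinate is kept, unlike in \<open>polytope_of\<close>. The use of
  \<open>x (\<pi> i)\<close> instead of the inverse permutation gives the same set, because
  inversion merely reindexes the weights.\<close>

definition perm_hull :: "nat \<Rightarrow> (nat \<Rightarrow> real) \<Rightarrow> (nat \<Rightarrow> real) set" where
  "perm_hull d x = {y. \<exists>l. (\<forall>\<pi>. \<pi> permutes {..<d} \<longrightarrow> l \<pi> \<ge> 0) \<and>
     (\<Sum>\<pi> | \<pi> permutes {..<d}. l \<pi>) = 1 \<and>
     (\<forall>i<d. y i = (\<Sum>\<pi> | \<pi> permutes {..<d}. l \<pi> * x (\<pi> i)))}"

lemma perm_hull_refl:
  assumes "\<And>i. i < d \<Longrightarrow> y i = x i"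
  shows "y \<in> perm_hull d x"
proof -
  have "finite {\<pi>. \<pi> permutes {..<d}}" by (simp add: finite_permutations)
  then have s: "(\<Sum>\<pi> | \<pi> permutes {..<d}. (if \<pi> = id then 1 else 0) * f \<pi>) = f id"
    for f :: "(nat \<Rightarrow> nat) \<Rightarrow> real"
    by (simp add: if_distrib[of "\<lambda>u. u * _"] permutes_id cong: if_cong)
  show ?thesis
    unfolding perm_hull_def
    using s[of "\<lambda>_. 1"] s[of "\<lambda>\<pi>. x (\<pi> _)"] assms
    by (auto intro!: exI[of _ "\<lambda>\<pi>. if \<pi> = id then 1 else 0"])
qed

text \<open>Since \<open>y (\<sigma> i)\<close> mixes the values
  \<open>x (\<pi> (\<sigma> i))\<close>, the weight of \<open>\<pi>\<close> moves to
  \<open>\<pi> \<circ> \<sigma>\<close>. The new weight at \<open>\<pi>\<close> is therefore the old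
  one at \<open>\<pi>\<close> composed with the inverse of \<open>\<sigma>\<close>.\<close>

lemma perm_hull_compose:
  assumes "y \<in> perm_hull d x" and \<sigma>: "\<sigma> permutes {..<d}"
  shows "y \<circ> \<sigma> \<in> perm_hull d x"
proof -
  obtain l where l: "\<forall>\<pi>. \<pi> permutes {..<d} \<longrightarrow> l \<pi> \<ge> 0" "(\<Sum>\<pi> | \<pi> permutes {..<d}. l \<pi>) = 1"
    "\<forall>i<d. y i = (\<Sum>\<pi> | \<pi> permutes {..<d}. l \<pi> * x (\<pi> i))"
    using assms(1) by (auto simp: perm_hull_def)
  have sub: "(\<Sum>\<pi> | \<pi> permutes {..<d}. f (\<pi> \<circ> inv_into UNIV \<sigma>)) = (\<Sum>\<pi> | \<pi> permutes {..<d}. f \<pi>)"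
    for f :: "(nat \<Rightarrow> nat) \<Rightarrow> real"
    using sum_permutations_compose_right[OF permutes_inv[OF \<sigma>], of f] by simp
  have "(y \<circ> \<sigma>) i = (\<Sum>\<pi> | \<pi> permutes {..<d}. l (\<pi> \<circ> inv_into UNIV \<sigma>) * x (\<pi> i))" if "i < d" for i
  proof -
    have "\<sigma> i < d" using permutes_in_image[OF \<sigma>, of i] that by simp
    then show ?thesis
      using l(3) sub[of "\<lambda>\<pi>. l \<pi> * x (\<pi> (\<sigma> i))"] by (simp add: permutes_inverses[OF \<sigma>])
  qed
  then show ?thesis
    unfolding perm_hull_def using l(1) sub[of l] l(2) permutes_compose[OF permutes_inv[OF \<sigma>]]
    by (auto intro!: exI[of _ "\<lambda>\<pi>. l (\<pi> \<circ> inv_into UNIV \<sigma>)"])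
qed

text \<open>This lets a T-transform be undone on the side of the generating vector: a fraction
  \<open>u\<close> of the weight of each \<open>\<pi>\<close> is passed on to
  \<open>\<tau> \<circ> \<pi>\<close>. With \<open>u = 1\<close> it covers a plain permutation of
  \<open>x\<close>.\<close>

lemma perm_hull_mix:
  assumes "y \<in> perm_hull d (\<lambda>i. (1 - u) * x i + u * x (\<tau> i))" and \<tau>: "\<tau> permutes {..<d}"
    and u: "0 \<le> u" "u \<le> 1"
  shows "y \<in> perm_hull d x"
proof -
  let ?P = "{\<pi>. \<pi> permutes {..<d}}"
  obtain l where l: "\<forall>\<pi>. \<pi> permutes {..<d} \<longrightarrow> l \<pi> \<ge> 0" "(\<Sum>\<pi>\<in>?P. l \<pi>) = 1"
    "\<forall>i<d. y i = (\<Sum>\<pi>\<in>?P. l \<pi> * ((1 - u) * x (\<pi> i) + u * x (\<tau> (\<pi> i))))"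
    using assms(1) by (auto simp: perm_hull_def)
  have sub: "(\<Sum>\<pi>\<in>?P. f (inv_into UNIV \<tau> \<circ> \<pi>)) = (\<Sum>\<pi>\<in>?P. f \<pi>)"
    for f :: "(nat \<Rightarrow> nat) \<Rightarrow> real"
    using setum_permutations_compose_left[OF permutes_inv[OF \<tau>], of f] by simp
  define k where "k \<pi> = (1 - u) * l \<pi> + u * l (inv_into UNIV \<tau> \<circ> \<pi>)" for \<pi>
  have "\<forall>\<pi>. \<pi> permutes {..<d} \<longrightarrow> k \<pi> \<ge> 0"
    using l(1) u permutes_compose[OF _ permutes_inv[OF \<tau>]] by (simp add: k_def)
  moreover have "(\<Sum>\<pi>\<in>?P. k \<pi>) = 1"
    using sub[of l] l(2) by (simp add: k_def sum.distrib flip: sum_distrib_left)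
  moreover have "y i = (\<Sum>\<pi>\<in>?P. k \<pi> * x (\<pi> i))" if "i < d" for i
  proof -
    have "y i = (1 - u) * (\<Sum>\<pi>\<in>?P. l \<pi> * x (\<pi> i)) + u * (\<Sum>\<pi>\<in>?P. l \<pi> * x (\<tau> (\<pi> i)))"
      using l(3) that by (simp add: sum_distrib_left algebra_simps flip: sum.distrib)
    also have "(\<Sum>\<pi>\<in>?P. l \<pi> * x (\<tau> (\<pi> i))) = (\<Sum>\<pi>\<in>?P. l (inv_into UNIV \<tau> \<circ> \<pi>) * x (\<pi> i))"
      using sub[of "\<lambda>\<pi>. l \<pi> * x (\<tau> (\<pi> i))"] by (simp add: permutes_inverses[OF \<tau>])
    finally show ?thesis
      by (simp add: k_def sum_distrib_left algebra_simps flip: sum.distrib)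
  qed
  ultimately show ?thesis unfolding perm_hull_def by blast
qed

lemma perm_hull_permuted:
  assumes "y \<in> perm_hull d (x \<circ> \<tau>)" and "\<tau> permutes {..<d}"
  shows "y \<in> perm_hull d x"
  using perm_hull_mix[of y d 1 x \<tau>] assms by (simp add: comp_def)

section \<open>From dominated prefix sums to the hull by T-transforms\<close>

lemma sum_fun_upd_diff:
  fixes f :: "nat \<Rightarrow> real"
  shows "(\<Sum>i<m. (f(k := a)) i) = (\<Sum>i<m. f i) + (if k < m then a - f k else 0)"
proof -
  have "(\<Sum>i<m. (f(k := a)) i) = (\<Sum>i<m. f i + (if i = k then a - f k else 0))"
    by (intro sum.cong) auto
  then show ?thesis by (simp add: sum.distrib)
qed

text \<open>Induction on the number of coordinates where \<open>x\<close> and \<open>y\<close>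
  differ. The order is imposed on \<open>y\<close> alone, since a T-transform may destroy that of
  \<open>x\<close>, while \<open>y\<close> stays fixed throughout.\<close>

lemma perm_hull_if_prefix_sums_le:
  assumes "antimono_on {..<d} y"
    and "\<And>m. m \<le> d \<Longrightarrow> (\<Sum>i<m. y i) \<le> (\<Sum>i<m. x i)"
    and "(\<Sum>i<d. y i) = (\<Sum>i<d. x i)"
  shows "y \<in> perm_hull d x"
  using assms(2,3)
proof (induction "card {i. i < d \<and> x i \<noteq> y i}" arbitrary: x rule: less_induct)
  case less
  show ?case
  proof (cases "\<exists>k<d. x k < y k")
    case False
    \<comment> \<open>Here \<open>x\<close> dominates \<open>y\<close> coordinatewise, and equal
      totals leave no room for a strict inequality.\<close>
    then have "\<forall>i<d. y i \<le> x i" by (blast intro: leI)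
    then have "y i = x i" if "i < d" for i
      using that by (intro sum_mono_inv[OF less.prems(2)]) auto
    then show ?thesis by (intro perm_hull_refl) simp
  next
    case True
    \<comment> \<open>The first coordinate at which \<open>x\<close> has a deficit. Some earlier
      \<open>j\<close> must have a surplus, for otherwise the prefix of length \<open>Suc k\<close>
      would violate the hypothesis.\<close>
    define k where "k = (LEAST k. k < d \<and> x k < y k)"
    have k: "k < d" "x k < y k"
      using LeastI_ex[of "\<lambda>k. k < d \<and> x k < y k"] True by (auto simp: k_def)
    have below: "y i \<le> x i" if "i < k" for i
      using not_less_Least[of i "\<lambda>k. k < d \<and> x k < y k"] that k(1) by (force simp: k_def)
    have "\<exists>j<k. y j < x j"
    proof (rule ccontr)
      assume "\<not> (\<exists>j<k. y j < x j)"
      then have "\<forall>i<k. x i \<le> y i" by (blast intro: leI)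
      then have "(\<Sum>i<k. x i) \<le> (\<Sum>i<k. y i)" by (intro sum_mono) simp
      then show False using less.prems(1)[of "Suc k"] k by simp
    qed
    then obtain j where j: "j < k" "y j < x j" by auto
    \<comment> \<open>Hence \<open>x k < y k \<le> y j < x j\<close>, so the denominator of
      \<open>u\<close> is positive and \<open>e\<close> is at most \<open>x j - x k\<close>.\<close>
    have yjk: "y k \<le> y j" using assms(1) j k by (auto simp: monotone_on_def)
    \<comment> \<open>The largest amount that can move from \<open>j\<close> to \<open>k\<close>
      without overshooting \<open>y\<close> at either place; \<open>u\<close> is the share of the
      transposed vector that moves exactly this amount.\<close>
    define e where "e = min (x j - y j) (y k - x k)"
    define x' where "x' = x(j := x j - e, k := x k + e)"
    define u where "u = e / (x j - x k)"
    have e: "0 < e" "e \<le> x j - y j" "e \<le> y k - x k" using j k by (auto simp: e_def)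
    have u: "0 \<le> u" "u \<le> 1" "u * (x j - x k) = e" using e j k yjk by (auto simp: u_def)
    have x': "x' = (\<lambda>i. (1 - u) * x i + u * x (transpose j k i))"
      using u(3) j(1) by (auto simp: x'_def transpose_def fun_eq_iff algebra_simps)
    have sum_x': "(\<Sum>i<m. x' i) = (\<Sum>i<m. x i) - (if j < m \<and> m \<le> k then e else 0)" for m
      using j(1) unfolding x'_def sum_fun_upd_diff by auto
    have agree: "x i \<noteq> y i" if "x' i \<noteq> y i" for i
      using that j(2) k(2) by (cases "i = j \<or> i = k") (auto simp: x'_def)
    \<comment> \<open>The minimum in \<open>e\<close> is attained, so \<open>j\<close> or
      \<open>k\<close> starts to agree. By \<open>agree\<close> no coordinate is lost, and the
      measure drops.\<close>
    have "x' j = y j \<or> x' k = y k" using j(1) by (auto simp: x'_def e_def)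
    then obtain i where "i \<in> {j, k}" "x' i = y i" by blast
    moreover from this have "i < d" "x i \<noteq> y i" using j k by auto
    ultimately have "{i. i < d \<and> x' i \<noteq> y i} \<subset> {i. i < d \<and> x i \<noteq> y i}"
      using agree by blast
    then have "card {i. i < d \<and> x' i \<noteq> y i} < card {i. i < d \<and> x i \<noteq> y i}"
      by (intro psubset_card_mono) auto
    moreover have "(\<Sum>i<m. y i) \<le> (\<Sum>i<m. x' i)" if "m \<le> d" for m
    \<comment> \<open>Only prefixes that contain \<open>j\<close> but not \<open>k\<close> lose
      \<open>e\<close>. All their terms \<open>x i - y i\<close> are nonnegative by minimality of
      \<open>k\<close>, and the term at \<open>j\<close> alone already covers
      \<open>e\<close>.\<close>
    proof (cases "j < m \<and> m \<le> k")
      case True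
      have "e \<le> x j - y j" by (fact e)
      also have "\<dots> \<le> (\<Sum>i<m. x i - y i)"
        using True below by (intro member_le_sum) auto
      finally show ?thesis using True by (simp add: sum_x' sum_subtractf)
    next
      case False
      show ?thesis using less.prems(1)[OF that] by (simp only: sum_x' False if_False diff_0_right)
    qed
    moreover have "(\<Sum>i<d. y i) = (\<Sum>i<d. x' i)" using less.prems(2) k by (simp add: sum_x')
    ultimately have "y \<in> perm_hull d x'" by (rule less.hyps)
    then show ?thesis
      unfolding x' by (rule perm_hull_mix) (use j k u in \<open>auto intro!: permutes_swap_id\<close>)
  qed
qed

section \<open>Sorting, and prefix sums under a doubly stochastic matrix\<close>

lemma sorting_permutation_exists:
  fixes x :: "nat \<Rightarrow> real"
  obtains \<sigma> where "\<sigma> permutes {..<d}" "antimono_on {..<d} (x \<circ> \<sigma>)"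
proof -
  let ?xs = "map x [0..<d]" and ?ys = "rev (sort (map x [0..<d]))"
  have "mset ?ys = mset ?xs" by simp
  then obtain \<sigma> where \<sigma>: "\<sigma> permutes {..<length ?xs}" "permute_list \<sigma> ?xs = ?ys"
    by (rule mset_eq_permutation)
  have eq: "x (\<sigma> i) = ?ys ! i" if "i < d" for i
  proof -
    have "\<sigma> i < d" using permutes_in_image[OF \<sigma>(1), of i] that by simp
    then show ?thesis
      using permute_list_nth[OF \<sigma>(1), of i] that by (simp add: \<sigma>(2))
  qed
  have "antimono_on {..<d} (x \<circ> \<sigma>)"
  proof (rule monotone_onI)
    fix i j assume ij: "i \<in> {..<d}" "j \<in> {..<d}" "i \<le> j"
    then show "(x \<circ> \<sigma>) i \<ge> (x \<circ> \<sigma>) j"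
      by (auto simp: eq rev_nth intro!: sorted_nth_mono)
  qed
  then show ?thesis using \<sigma>(1) that by simp
qed

lemma sum_permutes:
  assumes "\<sigma> permutes {..<d}"
  shows "(\<Sum>i<d. f (\<sigma> i)) = (\<Sum>i<(d::nat). f i)"
  using sum.permute[OF assms, of f] by (simp add: comp_def)

text \<open>Adding the first \<open>m\<close> columns gives each \<open>x i\<close> a weight
  \<open>c i\<close> between 0 and 1, with total \<open>m\<close>. For decreasing \<open>x\<close>
  no such weighting beats the indicator \<open>b\<close> of the first \<open>m\<close>
  positions.\<close>

lemma prefix_sums_doubly_stochastic_le:
  fixes A :: "nat \<Rightarrow> nat \<Rightarrow> real"
  assumes x: "antimono_on {..<d} x"
    and A0: "\<And>i j. i < d \<Longrightarrow> j < d \<Longrightarrow> A i j \<ge> 0"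
    and rows: "\<And>i. i < d \<Longrightarrow> (\<Sum>j<d. A i j) = 1"
    and cols: "\<And>j. j < d \<Longrightarrow> (\<Sum>i<d. A i j) = 1"
    and m: "m \<le> d"
  shows "(\<Sum>j<m. \<Sum>i<d. x i * A i j) \<le> (\<Sum>i<m. x i)"
proof (cases m)
  case (Suc n)
  define c where "c i = (\<Sum>j<m. A i j)" for i
  define b where "b i = (if i < m then 1 else 0 :: real)" for i
  have c: "0 \<le> c i" "c i \<le> 1" if "i < d" for i
    using that m A0 sum_mono2[of "{..<d}" "{..<m}" "A i"]
    by (auto simp: c_def rows intro!: sum_nonneg)
  have "(\<Sum>i<d. c i) = (\<Sum>j<m. \<Sum>i<d. A i j)"
    unfolding c_def by (rule sum.swap)
  then have sc: "(\<Sum>i<d. c i) = m" using cols m by simp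
  have sb: "(\<Sum>i<d. f i * b i) = (\<Sum>i<m. f i)" for f :: "nat \<Rightarrow> real"
  proof -
    have "(\<Sum>i<d. f i * b i) = (\<Sum>i<m. f i * b i)"
      using m by (intro sum.mono_neutral_right) (auto simp: b_def)
    then show ?thesis by (simp add: b_def)
  qed
  \<comment> \<open>The pivot \<open>x n\<close> with \<open>n = m - 1\<close> is the last entry of
    the prefix. Before \<open>m\<close> the first factor is nonnegative and the second nonpositive;
    from \<open>m\<close> on the signs are reversed.\<close>
  have "(\<Sum>i<d. (x i - x n) * (c i - b i)) \<le> 0"
  proof (rule sum_nonpos)
    fix i assume i: "i \<in> {..<d}"
    show "(x i - x n) * (c i - b i) \<le> 0"
    proof (cases "i < m")
      case True
      then have "x n \<le> x i" using x i Suc m by (auto simp: monotone_on_def)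
      then show ?thesis using True c[of i] i by (simp add: b_def mult_nonneg_nonpos)
    next
      case False
      then have "x i \<le> x n" using x i Suc m by (auto simp: monotone_on_def)
      then show ?thesis using False c[of i] i by (simp add: b_def mult_nonpos_nonneg)
    qed
  qed
  \<comment> \<open>The factor 1 makes the total of \<open>b\<close> an instance of
    \<open>sb\<close>. Both weightings have total \<open>m\<close>, so the pivot cancels.\<close>
  also have "(\<Sum>i<d. (x i - x n) * (c i - b i)) =
      (\<Sum>i<d. x i * c i) - (\<Sum>i<d. x i * b i) - x n * ((\<Sum>i<d. c i) - (\<Sum>i<d. 1 * b i))"
    by (simp add: sum_distrib_left sum_subtractf algebra_simps sum.distrib)
  finally have "(\<Sum>i<d. x i * c i) \<le> (\<Sum>i<m. x i)"
    unfolding sb sc by simp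
  moreover have "(\<Sum>j<m. \<Sum>i<d. x i * A i j) = (\<Sum>i<d. x i * c i)"
    unfolding c_def sum_distrib_left by (rule sum.swap)
  ultimately show ?thesis by simp
qed simp

text \<open>Permuting the rows and columns of \<open>A\<close> by the sorting permutations yields a
  doubly stochastic \<open>B\<close> that carries sorted \<open>x\<close> to sorted
  \<open>y\<close>. There the prefix sum criterion applies, and the two sortings are then undone
  separately.\<close>

lemma doubly_stochastic_mult_in_perm_hull:
  fixes A :: "nat \<Rightarrow> nat \<Rightarrow> real"
  assumes A0: "\<And>i j. i < d \<Longrightarrow> j < d \<Longrightarrow> A i j \<ge> 0"
    and rows: "\<And>i. i < d \<Longrightarrow> (\<Sum>j<d. A i j) = 1"
    and cols: "\<And>j. j < d \<Longrightarrow> (\<Sum>i<d. A i j) = 1"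
  shows "(\<lambda>j. \<Sum>i<d. x i * A i j) \<in> perm_hull d x"
proof -
  define y where "y j = (\<Sum>i<d. x i * A i j)" for j
  obtain \<sigma> where \<sigma>: "\<sigma> permutes {..<d}" "antimono_on {..<d} (x \<circ> \<sigma>)"
    by (rule sorting_permutation_exists)
  obtain \<rho> where \<rho>: "\<rho> permutes {..<d}" "antimono_on {..<d} (y \<circ> \<rho>)"
    by (rule sorting_permutation_exists)
  have lt: "\<sigma> i < d" "\<rho> i < d" if "i < d" for i
    using permutes_in_image[OF \<sigma>(1), of i] permutes_in_image[OF \<rho>(1), of i] that by auto
  define B where "B i j = A (\<sigma> i) (\<rho> j)" for i j
  have y: "(y \<circ> \<rho>) j = (\<Sum>i<d. (x \<circ> \<sigma>) i * B i j)" for j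
    using sum_permutes[OF \<sigma>(1), of "\<lambda>i. x i * A i (\<rho> j)"] by (simp add: y_def B_def)
  have B: "\<And>i j. i < d \<Longrightarrow> j < d \<Longrightarrow> B i j \<ge> 0" "\<And>i. i < d \<Longrightarrow> (\<Sum>j<d. B i j) = 1"
    "\<And>j. j < d \<Longrightarrow> (\<Sum>i<d. B i j) = 1"
    using lt A0 rows cols sum_permutes[OF \<sigma>(1), of "\<lambda>i. A i (\<rho> _)"] sum_permutes[OF \<rho>(1), of "A (\<sigma> _)"]
    by (auto simp: B_def)
  have "(\<Sum>i<m. (y \<circ> \<rho>) i) \<le> (\<Sum>i<m. (x \<circ> \<sigma>) i)" if "m \<le> d" for m
    unfolding y using prefix_sums_doubly_stochastic_le[OF \<sigma>(2) B that] .
  moreover have "(\<Sum>j<d. (y \<circ> \<rho>) j) = (\<Sum>i<d. (x \<circ> \<sigma>) i)"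
  proof -
    have "(\<Sum>j<d. (y \<circ> \<rho>) j) = (\<Sum>i<d. \<Sum>j<d. (x \<circ> \<sigma>) i * B i j)"
      unfolding y by (rule sum.swap)
    then show ?thesis by (simp add: B(2) flip: sum_distrib_left)
  qed
  ultimately have "y \<circ> \<rho> \<in> perm_hull d (x \<circ> \<sigma>)"
    using \<rho>(2) by (intro perm_hull_if_prefix_sums_le)
  then have "y \<circ> \<rho> \<in> perm_hull d x" using \<sigma>(1) by (rule perm_hull_permuted)
  then have "(y \<circ> \<rho>) \<circ> inv_into UNIV \<rho> \<in> perm_hull d x"
    by (rule perm_hull_compose[OF _ permutes_inv[OF \<rho>(1)]])
  then have "y \<in> perm_hull d x" by (simp add: comp_assoc permutes_inv_o[OF \<rho>(1)])
  then show ?thesis by (simp add: y_def[abs_def])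
qed

section \<open>Row vectors and products of doubly stochastic matrices\<close>

lemma mult_vec_mat_index:
  assumes "x \<in> carrier_vec n" "A \<in> carrier_mat n m" "j < m"
  shows "(x \<^sub>v* A) $ j = (\<Sum>i<n. x $ i * A $$ (i, j))"
  using assms by (simp add: mult_vec_mat_def scalar_prod_def lessThan_atLeast0)

lemma mult_vec_mat_carrier:
  "A \<in> carrier_mat n m \<Longrightarrow> x \<^sub>v* A \<in> carrier_vec m"
  by (simp add: mult_vec_mat_def)

lemma mult_mat_index:
  fixes A B :: "real mat"
  assumes "A \<in> carrier_mat n m" "B \<in> carrier_mat m k" "i < n" "j < k"
  shows "(A * B) $$ (i, j) = (\<Sum>a<m. A $$ (i, a) * B $$ (a, j))"
  using assms by (auto simp: scalar_prod_def lessThan_atLeast0)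

lemma mult_vec_mat_assoc:
  assumes "x \<in> carrier_vec n" "A \<in> carrier_mat n m" "B \<in> carrier_mat m k"
  shows "(x \<^sub>v* A) \<^sub>v* B = x \<^sub>v* (A * B)"
proof (rule eq_vecI)
  fix j assume "j < dim_vec (x \<^sub>v* (A * B))"
  then have j: "j < k" using assms by (simp add: mult_vec_mat_def)
  have AB: "(A * B) $$ (i, j) = (\<Sum>a<m. A $$ (i, a) * B $$ (a, j))" if "i < n" for i
    using assms(2,3) that j by (rule mult_mat_index)
  have "((x \<^sub>v* A) \<^sub>v* B) $ j = (\<Sum>a<m. \<Sum>i<n. x $ i * A $$ (i, a) * B $$ (a, j))"
    using assms j
    by (simp add: mult_vec_mat_index[OF mult_vec_mat_carrier] mult_vec_mat_index sum_distrib_right)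
  also have "\<dots> = (\<Sum>i<n. \<Sum>a<m. x $ i * A $$ (i, a) * B $$ (a, j))"
    by (rule sum.swap)
  also have "\<dots> = (x \<^sub>v* (A * B)) $ j"
    using assms j by (subst mult_vec_mat_index[where n = n and m = k])
      (auto simp: AB sum_distrib_left mult.assoc simp del: index_mult_mat)
  finally show "((x \<^sub>v* A) \<^sub>v* B) $ j = (x \<^sub>v* (A * B)) $ j" .
qed (use assms in \<open>simp add: mult_vec_mat_def\<close>)

lemma doubly_stochastic_mult:
  assumes "doubly_stochastic d A" "doubly_stochastic d B"
  shows "doubly_stochastic d (A * B)"
proof -
  have AB: "(A * B) $$ (i, j) = (\<Sum>a<d. A $$ (i, a) * B $$ (a, j))" if "i < d" "j < d" for i j
    using assms that by (intro mult_mat_index) (auto simp: doubly_stochastic_def)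
  have "(\<Sum>j<d. (A * B) $$ (i, j)) = 1" if "i < d" for i
  proof -
    have "(\<Sum>j<d. (A * B) $$ (i, j)) = (\<Sum>a<d. \<Sum>j<d. A $$ (i, a) * B $$ (a, j))"
      using that by (subst sum.swap) (simp add: AB)
    then show ?thesis
      using assms that by (simp add: doubly_stochastic_def flip: sum_distrib_left)
  qed
  moreover have "(\<Sum>i<d. (A * B) $$ (i, j)) = 1" if "j < d" for j
  proof -
    have "(\<Sum>i<d. (A * B) $$ (i, j)) = (\<Sum>a<d. \<Sum>i<d. A $$ (i, a) * B $$ (a, j))"
      using that by (subst sum.swap) (simp add: AB)
    then show ?thesis
      using assms that by (simp add: doubly_stochastic_def flip: sum_distrib_right)
  qed
  moreover have "(A * B) $$ (i, j) \<ge> 0" if "i < d" "j < d" for i j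
    using assms that unfolding AB[OF that] by (auto simp: doubly_stochastic_def intro!: sum_nonneg)
  ultimately show ?thesis using assms by (auto simp: doubly_stochastic_def)
qed

lemma mult_vec_mat_sum:
  assumes "x \<in> carrier_vec d" "doubly_stochastic d A"
  shows "(\<Sum>j<d. (x \<^sub>v* A) $ j) = (\<Sum>i<d. x $ i)"
proof -
  have "(\<Sum>j<d. (x \<^sub>v* A) $ j) = (\<Sum>i<d. \<Sum>j<d. x $ i * A $$ (i, j))"
    using assms by (subst sum.swap) (simp add: mult_vec_mat_index[of x d A d] doubly_stochastic_def)
  then show ?thesis
    using assms by (simp add: doubly_stochastic_def flip: sum_distrib_left)
qed

lemma prob_vec_mult_doubly_stochastic:
  assumes "prob_vec d x" "doubly_stochastic d A"
  shows "prob_vec d (x \<^sub>v* A)"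
  using assms mult_vec_mat_sum[of x d A] mult_vec_mat_carrier[of A d d x]
  by (auto simp: prob_vec_def doubly_stochastic_def mult_vec_mat_index[of x d A d] intro!: sum_nonneg)

section \<open>The polytope and a single doubly stochastic step\<close>

text \<open>Turns the \<open>finsum_vec\<close> into real sums per coordinate. The carrier condition
  stays explicit because equal entries alone do not fix the dimension.\<close>

lemma polytope_of_eq:
  assumes "dim_vec x = d"
  shows "polytope_of x = {v \<in> carrier_vec (d - 1). \<exists>l.
    (\<forall>\<pi>. \<pi> permutes {..<d} \<longrightarrow> l \<pi> \<ge> 0) \<and> (\<Sum>\<pi> | \<pi> permutes {..<d}. l \<pi>) = 1 \<and>
    (\<forall>i<d - 1. v $ i = (\<Sum>\<pi> | \<pi> permutes {..<d}. l \<pi> * x $ inv_into UNIV \<pi> i))}"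
proof -
  let ?P = "{\<pi>. \<pi> permutes {..<d}}"
  define F where "F l = finsum_vec TYPE(real) (d - 1) (\<lambda>\<pi>. l \<pi> \<cdot>\<^sub>v trunc_vec (perm_vec \<pi> x)) ?P" for l
  have fin: "finite ?P" by (simp add: finite_permutations)
  have car: "(\<lambda>\<pi>. l \<pi> \<cdot>\<^sub>v trunc_vec (perm_vec \<pi> x)) \<in> ?P \<rightarrow> carrier_vec (d - 1)" for l
    using assms by (auto simp: trunc_vec_def perm_vec_eq)
  have Fc: "F l \<in> carrier_vec (d - 1)" for l
    unfolding F_def by (rule finsum_vec_closed[OF car])
  have Fi: "F l $ i = (\<Sum>\<pi>\<in>?P. l \<pi> * x $ inv_into UNIV \<pi> i)" if "i < d - 1" for l i
    unfolding F_def index_finsum_vec[OF fin that car]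
    using assms that by (intro sum.cong) (auto simp: trunc_vec_def perm_vec_eq)
  have "v = F l \<longleftrightarrow> v \<in> carrier_vec (d - 1) \<and>
      (\<forall>i<d - 1. v $ i = (\<Sum>\<pi>\<in>?P. l \<pi> * x $ inv_into UNIV \<pi> i))" for v l
    using Fc[of l] by (auto simp: Fi[symmetric] intro!: eq_vecI)
  then show ?thesis
    unfolding polytope_of_def assms F_def[symmetric] by blast
qed

lemma belongs_to_polytope_mult_doubly_stochastic:
  assumes "prob_vec d x" "doubly_stochastic d A"
  shows "belongs_to_polytope (x \<^sub>v* A) x"
proof -
  let ?P = "{\<pi>. \<pi> permutes {..<d}}"
  have x: "x \<in> carrier_vec d" "dim_vec x = d" using assms by (auto simp: prob_vec_def)
  have A: "A \<in> carrier_mat d d" using assms by (simp add: doubly_stochastic_def)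
  have "(\<lambda>j. \<Sum>i<d. x $ i * A $$ (i, j)) \<in> perm_hull d (($) x)"
    using doubly_stochastic_mult_in_perm_hull[of d "\<lambda>i j. A $$ (i, j)" "($) x"] assms(2)
    by (simp add: doubly_stochastic_def)
  then obtain l where l: "\<forall>\<pi>. \<pi> permutes {..<d} \<longrightarrow> l \<pi> \<ge> 0" "(\<Sum>\<pi>\<in>?P. l \<pi>) = 1"
    "\<forall>j<d. (\<Sum>i<d. x $ i * A $$ (i, j)) = (\<Sum>\<pi>\<in>?P. l \<pi> * x $ (\<pi> j))"
    by (auto simp: perm_hull_def)
  \<comment> \<open>\<open>perm_hull\<close> uses \<open>\<pi>\<close> where the polytope uses its
    inverse; inversion permutes the index set, so the weights are taken at the inverse
    permutation.\<close>
  have inv: "(\<Sum>\<pi>\<in>?P. f (inv_into UNIV \<pi>)) = (\<Sum>\<pi>\<in>?P. f \<pi>)" for f :: "(nat \<Rightarrow> nat) \<Rightarrow> real"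
    using sum_permutations_inverse[of f "{..<d}"] by simp
  have "(\<Sum>i<d. x $ i * A $$ (i, j)) = (\<Sum>\<pi>\<in>?P. l (inv_into UNIV \<pi>) * x $ inv_into UNIV \<pi> j)"
    if "j < d" for j
    using l(3) that inv[of "\<lambda>\<pi>. l \<pi> * x $ (\<pi> j)"] by simp
  moreover have "trunc_vec (x \<^sub>v* A) \<in> carrier_vec (d - 1)"
    using A by (simp add: trunc_vec_def mult_vec_mat_def)
  moreover have "trunc_vec (x \<^sub>v* A) $ j = (\<Sum>i<d. x $ i * A $$ (i, j))" if "j < d - 1" for j
    using that mult_vec_mat_index[OF x(1) A, of j] mult_vec_mat_carrier[OF A, of x]
    by (auto simp: trunc_vec_def)
  ultimately have "trunc_vec (x \<^sub>v* A) \<in> polytope_of x"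
    unfolding polytope_of_eq[OF x(2)] using l(1,2) inv[of l]
    by (auto intro!: exI[of _ "\<lambda>\<pi>. l (inv_into UNIV \<pi>)"] simp: permutes_inv)
  then show ?thesis
    using prob_vec_mult_doubly_stochastic[OF assms] x(2) by (simp add: belongs_to_polytope_def)
qed

lemma doubly_stochastic_if_belongs_to_polytope:
  assumes x: "prob_vec d x" and y: "belongs_to_polytope y x"
  shows "\<exists>M. doubly_stochastic d M \<and> y = x \<^sub>v* M"
proof -
  let ?P = "{\<pi>. \<pi> permutes {..<d}}"
  have xd: "x \<in> carrier_vec d" "dim_vec x = d" using x by (auto simp: prob_vec_def)
  have yp: "prob_vec d y" "trunc_vec y \<in> polytope_of x"
    using y xd by (auto simp: belongs_to_polytope_def)
  then have yd: "y \<in> carrier_vec d" by (simp add: prob_vec_def)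
  obtain l where l: "\<forall>\<pi>. \<pi> permutes {..<d} \<longrightarrow> l \<pi> \<ge> 0" "(\<Sum>\<pi>\<in>?P. l \<pi>) = 1"
    "\<forall>i<d - 1. trunc_vec y $ i = (\<Sum>\<pi>\<in>?P. l \<pi> * x $ inv_into UNIV \<pi> i)"
    using yp(2) unfolding polytope_of_eq[OF xd(2)] by blast
  \<comment> \<open>The convex combination of the matrices \<open>perm_mat d \<pi>\<close> with
    weights \<open>l\<close>, written entrywise.\<close>
  define M where "M = mat d d (\<lambda>(a, b). \<Sum>\<pi>\<in>?P. l \<pi> * (if \<pi> a = b then 1 else 0))"
  have M: "M \<in> carrier_mat d d" by (simp add: M_def)
  have Mi: "M $$ (a, b) = (\<Sum>\<pi>\<in>?P. l \<pi> * (if \<pi> a = b then 1 else 0))" if "a < d" "b < d" for a b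
    using that by (simp add: M_def)
  \<comment> \<open>Column \<open>b\<close> of a permutation matrix has its only 1 in row
    \<open>inv_into UNIV \<pi> b\<close>. A constant \<open>f\<close> gives the column sums of
    \<open>M\<close>, and the entries of \<open>x\<close> as \<open>f\<close> give the product with
    \<open>M\<close>.\<close>
  have col: "(\<Sum>a<d. f a * (if \<pi> a = b then 1 else 0)) = f (inv_into UNIV \<pi> b)"
    if "\<pi> \<in> ?P" "b < d" for \<pi> b and f :: "nat \<Rightarrow> real"
  proof -
    have \<pi>: "\<pi> permutes {..<d}" using that by simp
    have "inv_into UNIV \<pi> b < d" using permutes_in_image[OF permutes_inv[OF \<pi>], of b] that by simp
    moreover have "\<pi> a = b \<longleftrightarrow> a = inv_into UNIV \<pi> b" for a
      using permutes_inv_eq[OF \<pi>, of b a] by auto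
    ultimately show ?thesis by (simp add: if_distrib cong: if_cong)
  qed
  have ds: "doubly_stochastic d M"
    unfolding doubly_stochastic_def
  proof (intro conjI allI impI M)
    fix i j assume "i < d" "j < d"
    then show "M $$ (i, j) \<ge> 0" using l(1) by (auto simp: Mi intro!: sum_nonneg)
  next
    fix i assume i: "i < d"
    have "(\<Sum>j<d. M $$ (i, j)) = (\<Sum>\<pi>\<in>?P. \<Sum>j<d. l \<pi> * (if \<pi> i = j then 1 else 0))"
      using i by (subst sum.swap) (simp add: Mi)
    also have "\<dots> = (\<Sum>\<pi>\<in>?P. l \<pi>)"
      using i permutes_in_image[of _ "{..<d}" i]
      by (intro sum.cong) (auto simp: if_distrib cong: if_cong)
    finally show "(\<Sum>j<d. M $$ (i, j)) = 1" using l(2) by simp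
  next
    fix j assume j: "j < d"
    have "(\<Sum>i<d. M $$ (i, j)) = (\<Sum>\<pi>\<in>?P. \<Sum>i<d. l \<pi> * (if \<pi> i = j then 1 else 0))"
      using j by (subst sum.swap) (simp add: Mi)
    also have "\<dots> = (\<Sum>\<pi>\<in>?P. l \<pi>)" using j col by (intro sum.cong) auto
    finally show "(\<Sum>i<d. M $$ (i, j)) = 1" using l(2) by simp
  qed
  have xM: "(x \<^sub>v* M) $ j = (\<Sum>\<pi>\<in>?P. l \<pi> * x $ inv_into UNIV \<pi> j)" if j: "j < d" for j
  proof -
    have "(x \<^sub>v* M) $ j = (\<Sum>a<d. \<Sum>\<pi>\<in>?P. l \<pi> * (x $ a * (if \<pi> a = j then 1 else 0)))"
      unfolding mult_vec_mat_index[OF xd(1) M j] using j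
      by (intro sum.cong) (auto simp: Mi sum_distrib_left intro!: sum.cong)
    also have "\<dots> = (\<Sum>\<pi>\<in>?P. l \<pi> * (\<Sum>a<d. x $ a * (if \<pi> a = j then 1 else 0)))"
      by (subst sum.swap) (simp add: sum_distrib_left)
    also have "\<dots> = (\<Sum>\<pi>\<in>?P. l \<pi> * x $ inv_into UNIV \<pi> j)"
      using j by (intro sum.cong refl) (simp only: col)
    finally show ?thesis .
  qed
  have init: "y $ i = (x \<^sub>v* M) $ i" if "i < d - 1" for i
    using l(3) that yd by (auto simp: xM trunc_vec_def)
  \<comment> \<open>The polytope determines only the first \<open>d - 1\<close> entries; both
    vectors have total 1, which forces the last one to agree.\<close>
  have "(\<Sum>i<d. y $ i) = (\<Sum>i<d. (x \<^sub>v* M) $ i)"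
    using yp(1) prob_vec_mult_doubly_stochastic[OF x ds] by (simp add: prob_vec_def)
  then have "y $ i = (x \<^sub>v* M) $ i" if "i < d" for i
    using init that by (cases d) (auto simp: less_Suc_eq)
  then have "y = x \<^sub>v* M"
    using yd mult_vec_mat_carrier[OF M, of x] by (intro eq_vecI) auto
  then show ?thesis using ds by blast
qed

section \<open>The whole Markov chain\<close>

theorem proposition3p3:
  fixes d :: nat
    and x :: "nat \<Rightarrow> real vec"
    and D :: "nat \<Rightarrow> nat \<Rightarrow> real mat"
  assumes "d \<ge> 1"
    and "prob_vec d (x 1)"
    and "\<forall>s\<ge>1. doubly_stochastic d (D s (s + 1))"
    and "\<forall>s\<ge>1. x (s + 1) = x s \<^sub>v* D s (s + 1)"
  shows "(\<forall>s>0. belongs_to_polytope (x (s + 1)) (x 1)) \<and>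
    (\<forall>y. prob_vec d y \<and> belongs_to_polytope y (x 1) \<longrightarrow>
      (\<exists>M. doubly_stochastic d M \<and> y = x 1 \<^sub>v* M))"
proof -
  have x1: "x 1 \<in> carrier_vec d" using assms(2) by (simp add: prob_vec_def)
  \<comment> \<open>Any number of steps collapses into one, since the product of the transition
    matrices is again doubly stochastic. The induction really starts at one step, hence the case
    split on \<open>s = 0\<close>.\<close>
  have "\<exists>M. doubly_stochastic d M \<and> x (s + 1) = x 1 \<^sub>v* M" if "s > 0" for s
    using that
  proof (induction s)
    case (Suc s)
    show ?case
    proof (cases "s = 0")
      case True
      then show ?thesis using assms(3,4) by auto
    next
      case False
      then obtain M where M: "doubly_stochastic d M" "x (s + 1) = x 1 \<^sub>v* M" using Suc by auto
      let ?D = "D (s + 1) (s + 1 + 1)"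
      have D: "doubly_stochastic d ?D" using assms(3)[rule_format, of "s + 1"] by simp
      have "x (s + 1 + 1) = x (s + 1) \<^sub>v* ?D" using assms(4)[rule_format, of "s + 1"] by simp
      also have "\<dots> = x 1 \<^sub>v* (M * ?D)"
        unfolding M(2) using M(1) D x1 by (intro mult_vec_mat_assoc) (auto simp: doubly_stochastic_def)
      finally have "x (s + 1 + 1) = x 1 \<^sub>v* (M * ?D)" .
      then show ?thesis using doubly_stochastic_mult[OF M(1) D] by auto
    qed
  qed simp
  then have "\<forall>s>0. belongs_to_polytope (x (s + 1)) (x 1)"
    using belongs_to_polytope_mult_doubly_stochastic[OF assms(2)] by metis
  then show ?thesis
    using doubly_stochastic_if_belongs_to_polytope[OF assms(2)] by blast
qed

end
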